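(* For every integer $n\ge 1$, the number $\mathrm{Inv}(n)$ of (types of) invertible potentials in $n$ variables is $$\mathrm{Inv}(n)=1+2\sum_{k=2}^nP_1(k)+\sum_{k=4}^n\sum_{i=2}^{k-2}P_1(i)P_1(k-i),$$ where empty sums are zero.
   Context: $P(n)$ is the number of partitions of $n$, and $P_1(n)$ is the number of partitions of $n$ with no part equal to $1$ (so $P_1(n)=P(n)-P(n-1)$ for $n\geq 1$). Counting convention: a potential is represented by a graph whose vertices are the variables $x_1,\dots,x_n$; a monomial $x_i^a$ makes $x_i$ a root (no arrow), and a monomial $x_i^ax_j$ with $i\ne j$ is an arrow from $x_i$ to $x_j$. Invertible potentials are sums of $n$ monomials in $n$ variables that are combinations, in disjoint sets of variables, of isolated (Fermat) variables $x^a$, chains $x_1^{a_1}x_2+x_2^{a_2}x_3+\dots+x_{k-1}^{a_{k-1}}x_k+x_k^{a_k}$ ($k\ge2$), and loops $x_1^{a_1}x_2+x_2^{a_2}x_3+\dots+x_k^{a_k}x_1$ ($k\ge 2$). Equivalently, their types correspond to mappings $f$ of $n$ points to themselves such that no two distinct points $i\neq j$ map to a third point distinct from both; here $f(i)=i$ corresponds to a monomial $x_i^{a_i}$ and $f(i)=j\neq i$ to a monomial $x_i^{a_i}x_j$. $\mathrm{Inv}(n)$ is the number of such types, i.e. of such mappings up to relabelling of the $n$ points (the exponents are not counted). For example $\mathrm{Inv}(2)=3$, $\mathrm{Inv}(3)=5$, $\mathrm{Inv}(4)=10$. *)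

theory Defs
  imports "HOL-Library.Multiset" "HOL-Library.FuncSet" "HOL-Combinatorics.Permutations"
begin

text \<open>Partitions of \<open>n\<close> are multisets of positive integers with sum \<open>n\<close>.\<close>

definition partitions :: "nat \<Rightarrow> nat multiset set" where
  "partitions n = {M. 0 \<notin># M \<and> sum_mset M = n}"

definition P1 :: "nat \<Rightarrow> nat" where
  "P1 n = card {M \<in> partitions n. 1 \<notin># M}"

text \<open>
  The variables are \<open>x_1, \<dots>, x_n\<close>. In the map \<open>f\<close> encoding a potential (with its exponents
  forgotten), \<open>f i = i\<close> stands for the monomial \<open>x_i^a\<close> and \<open>f i = j \<noteq> i\<close> for the monomial
  \<open>x_i^a x_j\<close>. The potential is invertible iff no two distinct points are mapped to a third
  point distinct from both. The lemma \<open>no_third_point_iff_blocks\<close> below relates this to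
  sums of Fermat, chain and loop polynomials in disjoint sets of variables.
\<close>

definition no_third_point :: "'a set \<Rightarrow> ('a \<Rightarrow> 'a) \<Rightarrow> bool" where
  "no_third_point S f \<longleftrightarrow>
     \<not> (\<exists>i\<in>S. \<exists>j\<in>S. \<exists>k\<in>S. i \<noteq> j \<and> f i = k \<and> f j = k \<and> k \<noteq> i \<and> k \<noteq> j)"

definition inv_maps :: "nat \<Rightarrow> (nat \<Rightarrow> nat) set" where
  "inv_maps n = {f \<in> {1..n} \<rightarrow>\<^sub>E {1..n}. no_third_point {1..n} f}"

definition relabelling :: "nat \<Rightarrow> ((nat \<Rightarrow> nat) \<times> (nat \<Rightarrow> nat)) set" where
  "relabelling n = {(f, g) \<in> inv_maps n \<times> inv_maps n.
     \<exists>p. p permutes {1..n} \<and> (\<forall>i\<in>{1..n}. g (p i) = p (f i))}"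

definition Inv :: "nat \<Rightarrow> nat" where
  "Inv n = card (inv_maps n // relabelling n)"

lemma finite_inv_maps: "finite (inv_maps n)"
  by (rule finite_subset[of _ "{1..n} \<rightarrow>\<^sub>E {1..n}"]) (auto simp: inv_maps_def intro: finite_PiE)

lemma equiv_relabelling: "equiv (inv_maps n) (relabelling n)"
proof (rule equivI)
  show "relabelling n \<subseteq> inv_maps n \<times> inv_maps n"
    by (auto simp: relabelling_def)
  show "refl_on (inv_maps n) (relabelling n)"
    by (rule refl_onI) (auto simp: relabelling_def intro!: exI[of _ id] permutes_id)
  show "sym (relabelling n)"
  proof (rule symI)
    fix f g assume "(f, g) \<in> relabelling n"
    then obtain p where fg: "f \<in> inv_maps n" "g \<in> inv_maps n" and p: "p permutes {1..n}"
      and h: "\<forall>i\<in>{1..n}. g (p i) = p (f i)" by (auto simp: relabelling_def)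
    have "f (inv p i) = inv p (g i)" if "i \<in> {1..n}" for i
    proof -
      have "inv p i \<in> {1..n}" using permutes_in_image[OF permutes_inv[OF p]] that by blast
      then have "g (p (inv p i)) = p (f (inv p i))" using h by blast
      then show ?thesis using permutes_inverses[OF p] by metis
    qed
    then show "(g, f) \<in> relabelling n"
      using fg permutes_inv[OF p] by (auto simp: relabelling_def)
  qed
  show "trans (relabelling n)"
  proof (rule transI)
    fix f g h assume "(f, g) \<in> relabelling n" "(g, h) \<in> relabelling n"
    then obtain p q where fg: "f \<in> inv_maps n" "h \<in> inv_maps n"
      and p: "p permutes {1..n}" "\<forall>i\<in>{1..n}. g (p i) = p (f i)"
      and q: "q permutes {1..n}" "\<forall>i\<in>{1..n}. h (q i) = q (g i)"
      by (auto simp: relabelling_def)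
    have "h ((q \<circ> p) i) = (q \<circ> p) (f i)" if "i \<in> {1..n}" for i
      using that p(2) q(2) permutes_in_image[OF p(1)] by simp
    then show "(f, h) \<in> relabelling n"
      using fg permutes_compose[OF p(1) q(1)] unfolding relabelling_def by blast
  qed
qed

text \<open>
  A block \<open>[i_1, \<dots>, i_k]\<close> is the summand
  \<open>x_{i_1}^{a_1} x_{i_2} + \<dots> + x_{i_{k-1}}^{a_{k-1}} x_{i_k} + m\<close>
  in which the last monomial \<open>m\<close> is \<open>x_{i_k}^{a_k}\<close> (a chain) or \<open>x_{i_k}^{a_k} x_{i_1}\<close> (a loop).
  For \<open>k = 1\<close> both alternatives are the Fermat summand \<open>x_{i_1}^{a_1}\<close>.
\<close>

definition block :: "('a \<Rightarrow> 'a) \<Rightarrow> 'a list \<Rightarrow> bool" where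
  "block f xs \<longleftrightarrow> xs \<noteq> [] \<and> distinct xs \<and>
     (\<forall>i. Suc i < length xs \<longrightarrow> f (xs ! i) = xs ! Suc i) \<and>
     (f (last xs) = last xs \<or> f (last xs) = hd xs)"

lemma block_closed:
  assumes "block f xs" "x \<in> set xs"
  shows "f x \<in> set xs"
proof -
  obtain i where i: "i < length xs" "x = xs ! i" using assms(2) by (metis in_set_conv_nth)
  show ?thesis
  proof (cases "Suc i < length xs")
    case True
    then show ?thesis using assms(1) i by (auto simp: block_def)
  next
    case False
    then have "x = last xs" using i by (metis One_nat_def Suc_lessI diff_Suc_1 last_conv_nth
          length_greater_0_conv less_nat_zero_code list.size(3))
    then show ?thesis using assms(1) by (auto simp: block_def)
  qed
qed

lemma block_no_third_point:
  assumes "block f xs"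
  shows "no_third_point (set xs) f"
proof -
  have step: "f (xs ! i) = (if Suc i < length xs then xs ! Suc i else f (last xs))"
    if "i < length xs" for i
  proof (cases "Suc i < length xs")
    case True
    then show ?thesis using assms by (simp add: block_def)
  next
    case False
    then have "i = length xs - 1" using that by simp
    then show ?thesis using False assms by (simp add: block_def last_conv_nth)
  qed
  have d: "distinct xs" "xs \<noteq> []" using assms by (auto simp: block_def)
  have "f (xs ! i) = xs ! i \<or> f (xs ! i) = xs ! j"
    if "i < j" "j < length xs" "f (xs ! i) = f (xs ! j)" for i j
  proof -
    have fi: "f (xs ! i) = xs ! Suc i" using that step[of i] by simp
    show ?thesis
    proof (cases "Suc j < length xs")
      case True
      then have "xs ! Suc i = xs ! Suc j" using that step[of j] fi by simp
      then show ?thesis using that True d by (simp add: nth_eq_iff_index_eq)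
    next
      case False
      then have j: "j = length xs - 1" using that by simp
      then have l: "last xs = xs ! j" using d by (simp add: last_conv_nth)
      have "f (xs ! j) = xs ! j \<or> f (xs ! j) = xs ! 0"
        using assms d l by (auto simp: block_def hd_conv_nth)
      moreover have "xs ! Suc i \<noteq> xs ! 0"
        using that d by (subst nth_eq_iff_index_eq) auto
      ultimately show ?thesis using fi that by metis
    qed
  qed
  note * = this
  show ?thesis
    unfolding no_third_point_def
  proof clarify
    fix u v assume h: "u \<in> set xs" "v \<in> set xs" "u \<noteq> v" "f v = f u" "f u \<noteq> u" "f u \<noteq> v"
    then obtain i j where ij: "i < length xs" "u = xs ! i" "j < length xs" "v = xs ! j"
      by (metis in_set_conv_nth)
    then consider "i < j" | "j < i" using h(3) by (metis linorder_neqE_nat)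
    then show False
      by cases (use *[of i j] *[of j i] h ij in auto)
  qed
qed

lemma ex_block:
  assumes "finite S" "f \<in> S \<rightarrow> S" "no_third_point S f" "S \<noteq> {}"
  shows "\<exists>xs. block f xs \<and> set xs \<subseteq> S \<and> f \<in> S - set xs \<rightarrow> S - set xs"
proof -
  have ntp: "f i = i \<or> f i = j" if "i \<in> S" "j \<in> S" "i \<noteq> j" "f i = f j" for i j
    using assms(2,3) that unfolding no_third_point_def by (metis Pi_mem)
  obtain s where s: "s \<in> S" "s \<notin> f ` S \<or> inj_on f S"
  proof (cases "f ` S = S")
    case True
    then show ?thesis using that assms(1,4) by (metis all_not_in_conv eq_card_imp_inj_on)
  next
    case False
    moreover have "f ` S \<subseteq> S" using assms(2) by auto
    ultimately show ?thesis using that by blast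
  qed
  define x where "x k = (f ^^ k) s" for k
  have x0: "x 0 = s" and xS: "x (Suc k) = f (x k)" for k by (simp_all add: x_def)
  have xin: "x k \<in> S" for k
    by (induction k) (use s assms(2) in \<open>auto simp: x0 xS\<close>)
  have "\<not> inj x" using xin assms(1) by (metis finite_imageD finite_subset image_subsetI infinite_UNIV_nat)
  then have ex: "\<exists>b. \<exists>a<b. x a = x b" unfolding inj_def by (metis linorder_neqE_nat)
  define b where "b = (LEAST b. \<exists>a<b. x a = x b)"
  obtain a where a: "a < b" "x a = x b" using LeastI_ex[OF ex] unfolding b_def by blast
  have ne: "x i \<noteq> x j" if "i < j" "j < b" for i j
    using not_less_Least[of j "\<lambda>b. \<exists>a<b. x a = x b"] that unfolding b_def by blast
  have ne': "x i \<noteq> x j" if "i \<noteq> j" "i < b" "j < b" for i j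
    using ne that by (metis linorder_neqE_nat)
  obtain c where c: "b = Suc c" using a by (cases b) auto
  have acase: "a = 0 \<or> a = c"
  proof (rule ccontr)
    assume "\<not> (a = 0 \<or> a = c)"
    then obtain a' where a': "a = Suc a'" "a' < c" "a < c" using a c by (cases a) auto
    have "f (x a') = f (x c)" using a a' c xS by metis
    then have "x a = x a' \<or> x a = x c" using ntp[of "x a'" "x c"] ne'[of a' c] xin a' c xS by auto
    then show False using ne' a' c by (metis a(1) less_SucI lessI nat_neq_iff)
  qed
  define xs where "xs = map x [0..<b]"
  have len: "length xs = b" and nth: "i < b \<Longrightarrow> xs ! i = x i" for i by (simp_all add: xs_def)
  have set: "set xs = x ` {0..<b}" by (simp add: xs_def)
  have last: "last xs = x c" and hd: "hd xs = x 0" and nemp: "xs \<noteq> []"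
    using c by (auto simp: xs_def hd_map simp del: upt_Suc simp: last_map)
  have "distinct xs" unfolding xs_def distinct_map by (auto intro!: inj_onI) (use ne' in blast)
  then have "block f xs"
    unfolding block_def last hd len using acase a nth nemp c xS by (metis Suc_lessD)
  moreover have "set xs \<subseteq> S" using set xin by auto
  moreover have "f y \<in> S - set xs" if y: "y \<in> S - set xs" for y
  proof (rule ccontr)
    assume "f y \<notin> S - set xs"
    then obtain k where k: "k < b" "f y = x k" using y assms(2) set by auto
    have yn: "y \<noteq> x i" if "i < b" for i using that y set by auto
    show False
    proof (cases k)
      case (Suc k')
      then have "f (x k') = f y" using k xS by simp
      then have "x k = x k' \<or> x k = y" using ntp[of "x k'" y] yn[of k'] k Suc xin y xS by auto
      then show False using ne'[of k' k] yn k Suc by force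
    next
      case 0
      then have inj: "inj_on f S" using s k x0 y by auto
      have "a = 0"
      proof (rule ccontr)
        assume "a \<noteq> 0"
        then obtain a' where a': "a = Suc a'" by (cases a) auto
        then have "x a' = x c" using a c xS inj xin by (metis inj_onD)
        then show False using ne[of a' c] a a' c by auto
      qed
      then have "y = x c" using k 0 a c xS inj xin y by (metis DiffD1 inj_onD)
      then show False using yn c by auto
    qed
  qed
  ultimately show ?thesis by auto
qed

lemma no_third_point_iff_blocks:
  assumes "finite S" "f \<in> S \<rightarrow> S"
  shows "no_third_point S f \<longleftrightarrow>
    (\<exists>B. (\<Union>xs\<in>B. set xs) = S \<and> (\<forall>xs\<in>B. block f xs) \<and>
         (\<forall>xs\<in>B. \<forall>ys\<in>B. xs \<noteq> ys \<longrightarrow> set xs \<inter> set ys = {}))"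
proof
  assume "no_third_point S f"
  with assms show "\<exists>B. (\<Union>xs\<in>B. set xs) = S \<and> (\<forall>xs\<in>B. block f xs) \<and>
         (\<forall>xs\<in>B. \<forall>ys\<in>B. xs \<noteq> ys \<longrightarrow> set xs \<inter> set ys = {})"
  proof (induction S rule: finite_psubset_induct)
    case (psubset S)
    show ?case
    proof (cases "S = {}")
      case True
      then show ?thesis by (intro exI[of _ "{}"]) auto
    next
      case False
      then obtain xs where xs: "block f xs" "set xs \<subseteq> S" "f \<in> S - set xs \<rightarrow> S - set xs"
        using ex_block psubset by metis
      have "hd xs \<in> set xs" using xs(1) by (simp add: block_def)
      then have "S - set xs \<subset> S" using xs(2) by blast
      moreover have "no_third_point (S - set xs) f"
        using psubset.prems(2) unfolding no_third_point_def by blast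
      ultimately obtain B where B: "(\<Union>ys\<in>B. set ys) = S - set xs" "\<forall>ys\<in>B. block f ys"
         "\<forall>ys\<in>B. \<forall>zs\<in>B. ys \<noteq> zs \<longrightarrow> set ys \<inter> set zs = {}"
        using psubset.IH xs(3) by meson
      have disj: "set ys \<inter> set xs = {}" if "ys \<in> B" for ys using B(1) that by blast
      show ?thesis
      proof (intro exI[of _ "insert xs B"] conjI)
        show "(\<Union>ys\<in>insert xs B. set ys) = S" using B(1) xs(2) by auto
        show "\<forall>ys\<in>insert xs B. block f ys" using B(2) xs(1) by auto
        show "\<forall>ys\<in>insert xs B. \<forall>zs\<in>insert xs B. ys \<noteq> zs \<longrightarrow> set ys \<inter> set zs = {}"
          using B(3) disj by (simp add: Int_commute)
      qed
    qed
  qed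
next
  assume "\<exists>B. (\<Union>xs\<in>B. set xs) = S \<and> (\<forall>xs\<in>B. block f xs) \<and>
         (\<forall>xs\<in>B. \<forall>ys\<in>B. xs \<noteq> ys \<longrightarrow> set xs \<inter> set ys = {})"
  then obtain B where B: "(\<Union>xs\<in>B. set xs) = S" "\<And>xs. xs \<in> B \<Longrightarrow> block f xs"
    "\<And>xs ys. xs \<in> B \<Longrightarrow> ys \<in> B \<Longrightarrow> xs \<noteq> ys \<Longrightarrow> set xs \<inter> set ys = {}" by metis
  show "no_third_point S f"
    unfolding no_third_point_def
  proof clarify
    fix i j assume h: "i \<in> S" "j \<in> S" "i \<noteq> j" "f j = f i" "f i \<noteq> i" "f i \<noteq> j"
    obtain xs ys where xy: "xs \<in> B" "i \<in> set xs" "ys \<in> B" "j \<in> set ys" using h B(1) by blast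
    then have "f i \<in> set xs" "f i \<in> set ys" using block_closed B(2) h(4) by metis+
    then have "xs = ys" using B(3) xy by blast
    then have "no_third_point (set xs) f" "j \<in> set xs" using block_no_third_point B(2) xy by auto
    then show False using h xy(2) \<open>f i \<in> set xs\<close> unfolding no_third_point_def by metis
  qed
qed

end

theory Submission
  imports Defs
begin

text \<open>
  An invertible map is a disjoint union of blocks, and a block is determined up to relabelling by
  its length together with one bit: whether it closes up to a loop or ends in a fixed point. A
  block of length 1 is a fixed point, so a loop must have length at least 2. The multiset of these
  (bit, length) pairs is a complete invariant of the map up to relabelling:

  \<^item> it is well defined because the point sets of the blocks are the connected components of the
    map, which do not depend on how it was decomposed (\<open>decomposes_imp_map_type\<close>);
  \<^item> maps with the same invariant are conjugate, by matching blocks of equal type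
    (\<open>decomposes_iso\<close>), and conjugate maps have the same invariant (\<open>decomposes_image\<close>);
  \<^item> every multiset of admissible pairs with total length \<open>n\<close> arises
    (\<open>ex_decomposes_of_type\<close>).

  Thus \<open>Inv n\<close> counts such multisets. Splitting off the loops leaves a partition of some \<open>i\<close> into
  parts at least 2 (the loops) and an arbitrary partition of \<open>n - i\<close> (the chains, where the parts
  1 are the Fermat variables). Since dropping the parts 1 gives \<open>P(m) = P1(0) + \<dots> + P1(m)\<close>, the
  count is the sum of \<open>P1 i * P1 j\<close> over all \<open>i + j \<le> n\<close>. Collecting terms by \<open>k = i + j\<close> and
  using \<open>P1 0 = 1\<close>, \<open>P1 1 = 0\<close> gives the formula: the terms \<open>i = 0\<close> and \<open>i = k\<close> contribute
  \<open>2 * P1 k\<close>, and the terms \<open>i = 1\<close> and \<open>i = k - 1\<close> vanish.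
\<close>

section \<open>Typed blocks\<close>

text \<open>
  The standard model of a block on the positions \<open>0, \<dots>, k - 1\<close>. Writing a block as a copy of this
  model makes any two blocks of the same type isomorphic position by position.
\<close>

definition next_pos :: "bool \<Rightarrow> nat \<Rightarrow> nat \<Rightarrow> nat" where
  "next_pos loop k i = (if Suc i < k then Suc i else if loop then 0 else i)"

text \<open>
  Loops are required to have length at least 2 so that the type of a block is unique: a loop and a
  chain of length 1 would be the same map.
\<close>

definition typed_block :: "('a \<Rightarrow> 'a) \<Rightarrow> bool \<Rightarrow> 'a list \<Rightarrow> bool" where
  "typed_block f loop xs \<longleftrightarrow> distinct xs \<and> xs \<noteq> [] \<and> (loop \<longrightarrow> 2 \<le> length xs) \<and>
     (\<forall>i<length xs. f (xs ! i) = xs ! next_pos loop (length xs) i)"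

lemma next_pos_less: "i < k \<Longrightarrow> next_pos loop k i < k"
  by (auto simp: next_pos_def)

lemma block_imp_typed_block:
  assumes "block f xs"
  shows "\<exists>loop. typed_block f loop xs"
proof -
  let ?loop = "f (last xs) \<noteq> last xs"
  have d: "distinct xs" "xs \<noteq> []"
    and step: "\<And>i. Suc i < length xs \<Longrightarrow> f (xs ! i) = xs ! Suc i"
    and close: "f (last xs) = last xs \<or> f (last xs) = hd xs"
    using assms by (auto simp: block_def)
  have "2 \<le> length xs" if ?loop
  proof (rule ccontr)
    assume "\<not> 2 \<le> length xs"
    with d(2) obtain x where "xs = [x]" by (cases xs) (auto simp: Suc_le_eq)
    with that close show False by simp
  qed
  moreover have "f (xs ! i) = xs ! next_pos ?loop (length xs) i" if "i < length xs" for i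
  proof (cases "Suc i < length xs")
    case True
    then show ?thesis using step by (simp add: next_pos_def)
  next
    case False
    then have "i = length xs - 1" using that by simp
    then have "xs ! i = last xs" using d(2) by (simp add: last_conv_nth)
    then show ?thesis using close d(2) False by (auto simp: next_pos_def hd_conv_nth)
  qed
  ultimately have "typed_block f ?loop xs" using d unfolding typed_block_def by blast
  then show ?thesis ..
qed

lemma typed_block_imp_block:
  assumes "typed_block f loop xs"
  shows "block f xs"
proof -
  have d: "distinct xs" "xs \<noteq> []"
    and step: "\<And>i. i < length xs \<Longrightarrow> f (xs ! i) = xs ! next_pos loop (length xs) i"
    using assms by (auto simp: typed_block_def)
  have "f (xs ! i) = xs ! Suc i" if "Suc i < length xs" for i
    using step[of i] that by (simp add: next_pos_def)
  moreover have "f (last xs) = last xs \<or> f (last xs) = hd xs"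
    using step[of "length xs - 1"] d(2) by (auto simp: next_pos_def last_conv_nth hd_conv_nth)
  ultimately show ?thesis using d by (simp add: block_def)
qed

lemma typed_block_closed:
  assumes "typed_block f loop xs"
  shows "f \<in> set xs \<rightarrow> set xs"
  using block_closed[OF typed_block_imp_block[OF assms]] by blast

lemma typed_block_map:
  assumes "typed_block f loop xs" "inj_on p (set xs)" "\<And>x. x \<in> set xs \<Longrightarrow> g (p x) = p (f x)"
  shows "typed_block g loop (map p xs)"
  using assms by (auto simp: typed_block_def distinct_map next_pos_less)

lemma typed_block_iso:
  assumes "typed_block f loop xs" "typed_block g loop ys" "length xs = length ys"
  shows "\<exists>p. bij_betw p (set xs) (set ys) \<and> (\<forall>x\<in>set xs. g (p x) = p (f x))"
proof -
  let ?I = "{..<length xs}"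
  have x: "bij_betw ((!) xs) ?I (set xs)" and y: "bij_betw ((!) ys) ?I (set ys)"
    using assms by (auto simp: typed_block_def intro!: bij_betw_nth)
  let ?p = "(!) ys \<circ> inv_into ?I ((!) xs)"
  have p: "?p (xs ! i) = ys ! i" if "i < length xs" for i
    using that bij_betw_inv_into_left[OF x] by simp
  have "bij_betw ?p (set xs) (set ys)"
    using bij_betw_trans[OF bij_betw_inv_into[OF x] y] .
  moreover have "g (?p x) = ?p (f x)" if x: "x \<in> set xs" for x
  proof -
    obtain i where i: "i < length xs" "x = xs ! i" using x unfolding in_set_conv_nth by blast
    have "g (?p x) = ys ! next_pos loop (length xs) i"
      using assms i p unfolding typed_block_def by simp
    also have "\<dots> = ?p (xs ! next_pos loop (length xs) i)"
      using p[OF next_pos_less[OF i(1)]] by simp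
    also have "\<dots> = ?p (f x)" using assms(1) i by (simp add: typed_block_def)
    finally show ?thesis .
  qed
  ultimately show ?thesis by blast
qed

text \<open>
  The type of a block can be recovered from its set of points alone: every chain has a fixed point
  (its last entry) and no loop of length at least 2 has one.
\<close>

definition set_type :: "('a \<Rightarrow> 'a) \<Rightarrow> 'a set \<Rightarrow> bool \<times> nat" where
  "set_type f K = (\<forall>x\<in>K. f x \<noteq> x, card K)"

lemma set_type_typed_block:
  assumes "typed_block f loop xs"
  shows "set_type f (set xs) = (loop, length xs)"
proof -
  have d: "distinct xs" "xs \<noteq> []" "loop \<Longrightarrow> 2 \<le> length xs"
    and step: "\<And>i. i < length xs \<Longrightarrow> f (xs ! i) = xs ! next_pos loop (length xs) i"
    using assms by (auto simp: typed_block_def)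
  have "(\<forall>x\<in>set xs. f x \<noteq> x) \<longleftrightarrow> loop"
  proof
    assume nofix: "\<forall>x\<in>set xs. f x \<noteq> x"
    let ?i = "length xs - 1"
    have i: "?i < length xs" "\<not> Suc ?i < length xs" using d(2) by (cases xs; simp)+
    show loop
    proof (rule ccontr)
      assume "\<not> loop"
      then have "f (xs ! ?i) = xs ! ?i" using step[OF i(1)] i(2) by (simp add: next_pos_def)
      then show False using nofix i(1) by auto
    qed
  next
    assume l: loop
    have "f (xs ! i) \<noteq> xs ! i" if "i < length xs" for i
    proof -
      have "next_pos loop (length xs) i \<noteq> i" using l d(3) by (auto simp: next_pos_def)
      then show ?thesis using step that d(1) next_pos_less by (simp add: nth_eq_iff_index_eq)
    qed
    then show "\<forall>x\<in>set xs. f x \<noteq> x" by (auto simp: in_set_conv_nth)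
  qed
  then show ?thesis using d(1) by (simp add: set_type_def distinct_card)
qed

section \<open>Decompositions into blocks\<close>

text \<open>
  \<open>decomposes f S M\<close> records only the types of the blocks, so that constructing, transporting and
  matching decompositions become inductions that add one block at a time.
\<close>

inductive decomposes :: "('a \<Rightarrow> 'a) \<Rightarrow> 'a set \<Rightarrow> (bool \<times> nat) multiset \<Rightarrow> bool"
  for f :: "'a \<Rightarrow> 'a" where
  empty: "decomposes f {} {#}"
| add: "decomposes f S M \<Longrightarrow> typed_block f loop xs \<Longrightarrow> S \<inter> set xs = {} \<Longrightarrow>
    decomposes f (S \<union> set xs) (add_mset (loop, length xs) M)"

lemma decomposes_finite: "decomposes f S M \<Longrightarrow> finite S"
  by (induction rule: decomposes.induct) auto

lemma decomposes_closed: "decomposes f S M \<Longrightarrow> f \<in> S \<rightarrow> S"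
  by (induction rule: decomposes.induct) (auto dest!: typed_block_closed)

lemma no_third_point_Un:
  assumes "no_third_point S f" "no_third_point T f" "f \<in> S \<rightarrow> S" "f \<in> T \<rightarrow> T" "S \<inter> T = {}"
  shows "no_third_point (S \<union> T) f"
  unfolding no_third_point_def
proof clarify
  fix i j
  assume h: "i \<in> S \<union> T" "j \<in> S \<union> T" "i \<noteq> j" "f j = f i" "f i \<noteq> i" "f i \<noteq> j"
  have "i \<in> S \<and> j \<in> S \<or> i \<in> T \<and> j \<in> T"
    using h(1,2,4) assms(3,4,5) by (metis Pi_mem UnE disjoint_iff)
  then show False
    using h(3-6) assms(1-4) unfolding no_third_point_def by (metis Pi_mem)
qed

lemma decomposes_no_third_point: "decomposes f S M \<Longrightarrow> no_third_point S f"
proof (induction rule: decomposes.induct)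
  case empty
  then show ?case by (simp add: no_third_point_def)
next
  case (add S M loop xs)
  have "no_third_point (set xs) f"
    using block_no_third_point[OF typed_block_imp_block[OF add.hyps(2)]] .
  from no_third_point_Un[OF add.IH this decomposes_closed[OF add.hyps(1)]
      typed_block_closed[OF add.hyps(2)] add.hyps(3)]
  show ?case .
qed

lemma ex_decomposes:
  assumes "finite S" "f \<in> S \<rightarrow> S" "no_third_point S f"
  shows "\<exists>M. decomposes f S M"
  using assms
proof (induction S rule: finite_psubset_induct)
  case (psubset S)
  show ?case
  proof (cases "S = {}")
    case True
    then show ?thesis using decomposes.empty by blast
  next
    case False
    then obtain xs where xs: "block f xs" "set xs \<subseteq> S" "f \<in> S - set xs \<rightarrow> S - set xs"
      using ex_block psubset by metis
    then obtain loop where loop: "typed_block f loop xs" using block_imp_typed_block by blast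
    have "S - set xs \<subset> S" using xs(1,2) by (auto simp: block_def neq_Nil_conv)
    moreover have "no_third_point (S - set xs) f"
      using psubset.prems(2) unfolding no_third_point_def by blast
    ultimately obtain M where "decomposes f (S - set xs) M" using psubset.IH xs(3) by blast
    from decomposes.add[OF this loop] show ?thesis
      using xs(2) by (auto simp: Un_absorb2)
  qed
qed

lemma decomposes_image:
  assumes "decomposes f S M" "inj_on p S" "\<And>x. x \<in> S \<Longrightarrow> g (p x) = p (f x)"
  shows "decomposes g (p ` S) M"
  using assms
proof (induction rule: decomposes.induct)
  case empty
  then show ?case by (simp add: decomposes.empty)
next
  case (add S M loop xs)
  have inj: "inj_on p S" "inj_on p (set xs)" using inj_on_subset[OF add.prems(1)] by blast+
  have 1: "decomposes g (p ` S) M" using add.IH inj add.prems(2) by blast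
  have 2: "typed_block g loop (map p xs)"
    using typed_block_map[OF add.hyps(2) inj(2)] add.prems(2) by blast
  have "p ` S \<inter> set (map p xs) = {}"
    using add.prems(1) add.hyps(3) by (auto dest: inj_onD)
  from decomposes.add[OF 1 2 this] show ?case by (simp add: image_Un)
qed

lemma decomposes_cong:
  assumes "decomposes f S M" "\<And>x. x \<in> S \<Longrightarrow> g x = f x"
  shows "decomposes g S M"
  using decomposes_image[of f S M id g] assms by simp

text \<open>
  The blocks are pairwise disjoint, so any one of them may be regarded as the last one added. This
  is the inversion used to match two decompositions block by block.
\<close>

lemma decomposes_remove:
  assumes "decomposes f S M" "t \<in># M"
  shows "\<exists>T xs. decomposes f T (M - {#t#}) \<and> typed_block f (fst t) xs \<and> length xs = snd t \<and>
    T \<inter> set xs = {} \<and> S = T \<union> set xs"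
  using assms
proof (induction rule: decomposes.induct)
  case empty
  then show ?case by simp
next
  case (add S M loop xs)
  show ?case
  proof (cases "t = (loop, length xs)")
    case True
    then show ?thesis using add.hyps by auto
  next
    case False
    then have tM: "t \<in># M" using add.prems by auto
    then obtain T ys where T: "decomposes f T (M - {#t#})" "typed_block f (fst t) ys"
      "length ys = snd t" "T \<inter> set ys = {}" "S = T \<union> set ys" using add.IH by blast
    have "T \<inter> set xs = {}" using T(5) add.hyps(3) by blast
    from decomposes.add[OF T(1) add.hyps(2) this]
    have "decomposes f (T \<union> set xs) (add_mset (loop, length xs) M - {#t#})"
      using False tM by simp
    moreover have "(T \<union> set xs) \<inter> set ys = {}" "S \<union> set xs = (T \<union> set xs) \<union> set ys"
      using T add.hyps(3) by auto
    ultimately show ?thesis using T(2,3) by blast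
  qed
qed

text \<open>
  A block of the type last added on the left also occurs on the right; the isomorphism of these two
  blocks is glued to the one given by induction on the remaining points.
\<close>

lemma decomposes_iso:
  assumes "decomposes f S M" "decomposes g T M"
  shows "\<exists>p. bij_betw p S T \<and> (\<forall>x\<in>S. g (p x) = p (f x))"
  using assms
proof (induction arbitrary: T rule: decomposes.induct)
  case empty
  then have "T = {}" by (cases rule: decomposes.cases) auto
  then show ?case by (simp add: bij_betw_def)
next
  case (add S M loop xs)
  obtain T' ys where T: "decomposes g T' M" "typed_block g loop ys"
    "length ys = length xs" "T' \<inter> set ys = {}" "T = T' \<union> set ys"
    using decomposes_remove[OF add.prems, of "(loop, length xs)"] by auto
  obtain p where p: "bij_betw p S T'" "\<forall>x\<in>S. g (p x) = p (f x)" using add.IH[OF T(1)] by blast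
  obtain q where q: "bij_betw q (set xs) (set ys)" "\<forall>x\<in>set xs. g (q x) = q (f x)"
    using typed_block_iso[OF add.hyps(2) T(2)] T(3) by auto
  let ?r = "\<lambda>x. if x \<in> S then p x else q x"
  have qr: "?r x = q x" if "x \<in> set xs" for x using that add.hyps(3) by auto
  have "bij_betw ?r S T'" using p(1) by (subst bij_betw_cong[of S _ p]) auto
  moreover have "bij_betw ?r (set xs) (set ys)"
    using q(1) qr by (subst bij_betw_cong[of "set xs" _ q]) auto
  ultimately have "bij_betw ?r (S \<union> set xs) T"
    using bij_betw_combine[of ?r S T' "set xs" "set ys"] T(4,5) by simp
  moreover have "g (?r x) = ?r (f x)" if "x \<in> S \<union> set xs" for x
  proof (cases "x \<in> S")
    case True
    then have "f x \<in> S" using decomposes_closed[OF add.hyps(1)] by blast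
    then show ?thesis using True p(2) by simp
  next
    case False
    then have x: "x \<in> set xs" using that by blast
    then have "f x \<in> set xs" using typed_block_closed[OF add.hyps(2)] by blast
    then show ?thesis using qr x q(2) by simp
  qed
  ultimately show ?case by blast
qed

section \<open>The type of a map\<close>

text \<open>
  Two points lie in the same weakly connected component of the graph of \<open>f\<close> iff their forward
  orbits meet.
\<close>

definition component :: "('a \<Rightarrow> 'a) \<Rightarrow> 'a set \<Rightarrow> 'a \<Rightarrow> 'a set" where
  "component f S x = {y \<in> S. \<exists>i j. (f ^^ i) x = (f ^^ j) y}"

definition map_type :: "('a \<Rightarrow> 'a) \<Rightarrow> 'a set \<Rightarrow> (bool \<times> nat) multiset" where
  "map_type f S = image_mset (set_type f) (mset_set (component f S ` S))"

lemma funpow_closed: "f \<in> S \<rightarrow> S \<Longrightarrow> x \<in> S \<Longrightarrow> (f ^^ i) x \<in> S"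
  by (induction i) auto

text \<open>
  Every orbit starting in a block passes through its last entry.
\<close>

lemma typed_block_connected:
  assumes "typed_block f loop xs" "x \<in> set xs" "y \<in> set xs"
  shows "\<exists>i j. (f ^^ i) x = (f ^^ j) y"
proof -
  have step: "f (xs ! i) = xs ! Suc i" if "Suc i < length xs" for i
    using assms(1) that by (simp add: typed_block_def next_pos_def)
  have shift: "(f ^^ d) (xs ! i) = xs ! (i + d)" if "i + d < length xs" for i d
    using that by (induction d) (auto simp: step)
  have "\<exists>i. (f ^^ i) x = xs ! (length xs - 1)" if x: "x \<in> set xs" for x
  proof -
    obtain i where "i < length xs" "x = xs ! i" using x unfolding in_set_conv_nth by blast
    moreover from this have "i + (length xs - 1 - i) = length xs - 1" "length xs - 1 < length xs"
      by linarith+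
    ultimately show ?thesis using shift[of i "length xs - 1 - i"] by auto
  qed
  then show ?thesis using assms(2,3) by metis
qed

lemma component_Un_left:
  assumes "f \<in> S \<rightarrow> S" "f \<in> T \<rightarrow> T" "S \<inter> T = {}" "x \<in> S"
  shows "component f (S \<union> T) x = component f S x"
proof -
  have "(f ^^ i) x \<noteq> (f ^^ j) y" if "y \<in> T" for i j y
    using assms that funpow_closed[of f S x i] funpow_closed[of f T y j] by auto
  then show ?thesis by (auto simp: component_def)
qed

text \<open>
  The right-hand side does not mention the decomposition, so the multiset of block types is an
  invariant of \<open>f\<close>. In the induction step, the added block is closed under \<open>f\<close>, as is its
  complement, so orbits from one never meet orbits from the other: the components of the old part
  are unchanged, and the connected new block is exactly one further component.
\<close>

lemma decomposes_imp_map_type: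
  assumes "decomposes f S M"
  shows "M = map_type f S"
  using assms
proof (induction rule: decomposes.induct)
  case empty
  then show ?case by (simp add: map_type_def)
next
  case (add S M loop xs)
  have cl: "f \<in> S \<rightarrow> S" "f \<in> set xs \<rightarrow> set xs"
    using decomposes_closed add.hyps(1) typed_block_closed add.hyps(2) by blast+
  have fin: "finite S" using decomposes_finite add.hyps(1) by blast
  have ne: "set xs \<noteq> {}" using add.hyps(2) by (simp add: typed_block_def)
  have S: "component f (S \<union> set xs) x = component f S x" if "x \<in> S" for x
    using component_Un_left cl add.hyps(3) that by metis
  have "component f (set xs \<union> S) x = component f (set xs) x" if "x \<in> set xs" for x
    using component_Un_left[of f "set xs" S x] cl add.hyps(3) that by (simp add: Int_commute)
  moreover have "component f (set xs) x = set xs" if "x \<in> set xs" for x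
    using typed_block_connected[OF add.hyps(2) that] by (auto simp: component_def)
  ultimately have xs: "component f (S \<union> set xs) x = set xs" if "x \<in> set xs" for x
    using that by (simp add: Un_commute)
  have "component f (S \<union> set xs) ` (S \<union> set xs) =
      component f (S \<union> set xs) ` S \<union> component f (S \<union> set xs) ` set xs" by blast
  also have "component f (S \<union> set xs) ` S = component f S ` S" using S by simp
  also have "component f (S \<union> set xs) ` set xs = {set xs}"
    using xs ne by (simp add: image_constant_conv)
  finally have "component f (S \<union> set xs) ` (S \<union> set xs) = insert (set xs) (component f S ` S)"
    by simp
  moreover have "set xs \<notin> component f S ` S"
    using ne add.hyps(3) by (auto simp: component_def)
  ultimately show ?case
    using add.IH fin set_type_typed_block[OF add.hyps(2)] by (simp add: map_type_def)
qed

definition types :: "nat \<Rightarrow> (bool \<times> nat) multiset set" where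
  "types n = {M. (\<forall>(loop, k)\<in>#M. 1 \<le> k \<and> (loop \<longrightarrow> 2 \<le> k)) \<and> \<Sum>\<^sub># (image_mset snd M) = n}"

lemma decomposes_imp_types: "decomposes f S M \<Longrightarrow> M \<in> types (card S)"
proof (induction rule: decomposes.induct)
  case empty
  then show ?case by (simp add: types_def)
next
  case (add S M loop xs)
  have "card (S \<union> set xs) = card S + length xs"
    using add.hyps decomposes_finite
    by (subst card_Un_disjoint) (auto simp: typed_block_def distinct_card)
  then show ?case
    using add.IH add.hyps(2) by (auto simp: types_def typed_block_def Suc_le_eq)
qed

lemma ex_typed_block:
  assumes "distinct xs" "xs \<noteq> []" "loop \<Longrightarrow> 2 \<le> length xs"
  shows "\<exists>f. typed_block f loop xs"
proof -
  \<comment> \<open>The definite description is the position of \<open>x\<close> in \<open>xs\<close>.\<close>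
  let ?f = "\<lambda>x. xs ! next_pos loop (length xs) (THE i. i < length xs \<and> xs ! i = x)"
  have "(THE j. j < length xs \<and> xs ! j = xs ! i) = i" if "i < length xs" for i
    using that assms(1) by (intro the_equality) (auto simp: nth_eq_iff_index_eq)
  then have "typed_block ?f loop xs" using assms by (simp add: typed_block_def)
  then show ?thesis by blast
qed

lemma typed_block_cong:
  "typed_block f loop xs \<Longrightarrow> (\<And>x. x \<in> set xs \<Longrightarrow> g x = f x) \<Longrightarrow> typed_block g loop xs"
  using typed_block_map[of f loop xs id g] by simp

text \<open>
  The blocks are laid out greedily on disjoint subsets of \<open>S\<close> of the prescribed sizes.
\<close>

lemma ex_decomposes_of_type:
  assumes "finite S" "M \<in> types (card S)"
  shows "\<exists>f. decomposes f S M"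
  using assms
proof (induction M arbitrary: S)
  case empty
  then have "S = {}" by (simp add: types_def)
  then show ?case using decomposes.empty by blast
next
  case (add t M)
  obtain loop k where t: "t = (loop, k)" by fastforce
  have k: "1 \<le> k" "loop \<Longrightarrow> 2 \<le> k" and kS: "k \<le> card S" and M: "M \<in> types (card S - k)"
    using add.prems(2) by (auto simp: types_def t)
  obtain K where K: "K \<subseteq> S" "card K = k" using kS obtain_subset_with_card_n by metis
  have finK: "finite K" using K(1) add.prems(1) finite_subset by blast
  obtain xs where xs: "set xs = K" "distinct xs" using finite_distinct_list[OF finK] by blast
  have len: "length xs = k" using xs K(2) distinct_card by metis
  have "xs \<noteq> []" using len k(1) by auto
  then obtain h where h: "typed_block h loop xs"
    using ex_typed_block[of xs loop] xs(2) len k(2) by blast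
  have "card (S - K) = card S - k" using K finK card_Diff_subset by metis
  then obtain g where g: "decomposes g (S - K) M"
    using add.IH[of "S - K"] add.prems(1) M by auto
  let ?f = "\<lambda>x. if x \<in> K then h x else g x"
  have "decomposes ?f (S - K) M" using decomposes_cong[OF g] by simp
  moreover have "typed_block ?f loop xs" using typed_block_cong[OF h] xs(1) by simp
  ultimately have "decomposes ?f (S - K \<union> set xs) (add_mset (loop, length xs) M)"
    using decomposes.add xs(1) by blast
  moreover have "S - K \<union> set xs = S" using xs(1) K(1) by blast
  ultimately show ?case using t len by auto
qed

lemma decomposes_map_type:
  assumes "f \<in> inv_maps n"
  shows "decomposes f {1..n} (map_type f {1..n})"
proof -
  have "f \<in> {1..n} \<rightarrow> {1..n}" "no_third_point {1..n} f"
    using assms by (auto simp: inv_maps_def)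
  then show ?thesis using ex_decomposes[of "{1..n}" f] decomposes_imp_map_type by blast
qed

lemma map_type_image: "(\<lambda>f. map_type f {1..n}) ` inv_maps n = types n"
proof (intro equalityI subsetI)
  fix M assume "M \<in> (\<lambda>f. map_type f {1..n}) ` inv_maps n"
  then show "M \<in> types n" using decomposes_imp_types[OF decomposes_map_type] by auto
next
  fix M assume "M \<in> types n"
  then obtain f where f: "decomposes f {1..n} M"
    using ex_decomposes_of_type[of "{1..n}" M] by auto
  let ?g = "restrict f {1..n}"
  have g: "decomposes ?g {1..n} M" using decomposes_cong[OF f] by simp
  then have "?g \<in> inv_maps n"
    using decomposes_no_third_point[OF g] decomposes_closed[OF f] by (auto simp: inv_maps_def)
  then show "M \<in> (\<lambda>f. map_type f {1..n}) ` inv_maps n"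
    using decomposes_imp_map_type[OF g] by blast
qed

lemma relabelling_iff_map_type:
  assumes "f \<in> inv_maps n" "g \<in> inv_maps n"
  shows "(f, g) \<in> relabelling n \<longleftrightarrow> map_type f {1..n} = map_type g {1..n}"
proof
  assume "(f, g) \<in> relabelling n"
  then obtain p where p: "p permutes {1..n}" "\<forall>i\<in>{1..n}. g (p i) = p (f i)"
    by (auto simp: relabelling_def)
  have "decomposes g (p ` {1..n}) (map_type f {1..n})"
    using decomposes_image[OF decomposes_map_type[OF assms(1)]] p permutes_inj_on[OF p(1)] by blast
  then show "map_type f {1..n} = map_type g {1..n}"
    using decomposes_imp_map_type permutes_image[OF p(1)] by metis
next
  assume "map_type f {1..n} = map_type g {1..n}"
  then obtain p where p: "bij_betw p {1..n} {1..n}" "\<forall>i\<in>{1..n}. g (p i) = p (f i)"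
    using decomposes_iso decomposes_map_type assms by metis
  \<comment> \<open>A permutation is the identity off its carrier; the bijection \<open>p\<close> is unspecified there.\<close>
  let ?q = "\<lambda>i. if i \<in> {1..n} then p i else i"
  have "bij_betw ?q {1..n} {1..n}" using p(1) by (subst bij_betw_cong[of _ _ p]) auto
  then have "?q permutes {1..n}" by (rule bij_imp_permutes) (rule if_not_P)
  moreover have "\<forall>i\<in>{1..n}. g (?q i) = ?q (f i)"
    using p(2) assms(1) by (auto simp: inv_maps_def PiE_iff)
  ultimately show "(f, g) \<in> relabelling n" using assms unfolding relabelling_def by blast
qed

lemma card_quotient_eq_card_image:
  assumes "equiv A r" "\<And>x y. x \<in> A \<Longrightarrow> y \<in> A \<Longrightarrow> (x, y) \<in> r \<longleftrightarrow> h x = h y"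
  shows "card (A // r) = card (h ` A)"
proof -
  have cls: "r `` {x} = {y \<in> A. h y = h x}" if "x \<in> A" for x
    using that assms equiv_type[OF assms(1)] by fastforce
  have "A // r = (\<lambda>c. {y \<in> A. h y = c}) ` h ` A"
    by (auto simp: quotient_def cls)
  moreover have "inj_on (\<lambda>c. {y \<in> A. h y = c}) (h ` A)"
    by (rule inj_onI) blast
  ultimately show ?thesis by (simp add: card_image)
qed

lemma Inv_eq_card_types: "Inv n = card (types n)"
  unfolding Inv_def map_type_image[symmetric]
  by (rule card_quotient_eq_card_image[OF equiv_relabelling relabelling_iff_map_type])

section \<open>Counting types\<close>

definition partitions_ge2 :: "nat \<Rightarrow> nat multiset set" where
  "partitions_ge2 n = {M \<in> partitions n. 1 \<notin># M}"

lemma P1_eq: "P1 n = card (partitions_ge2 n)"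
  by (simp add: P1_def partitions_ge2_def)

lemma finite_partitions: "finite (partitions n)"
proof (rule finite_subset)
  show "partitions n \<subseteq> mset ` {xs. set xs \<subseteq> {..n} \<and> length xs \<le> n}"
  proof
    fix M assume M: "M \<in> partitions n"
    obtain xs where xs: "mset xs = M" using ex_mset by blast
    have s: "sum_list xs = n" and pos: "0 \<notin> set xs"
      using M xs by (auto simp: partitions_def sum_mset_sum_list)
    have "length xs \<le> sum_list xs" using pos by (induction xs) auto
    moreover have "set xs \<subseteq> {..n}" using s member_le_sum_list by blast
    ultimately show "M \<in> mset ` {xs. set xs \<subseteq> {..n} \<and> length xs \<le> n}" using xs s by auto
  qed
  show "finite (mset ` {xs. set xs \<subseteq> {..n} \<and> length xs \<le> n})"
    by (intro finite_imageI finite_lists_length_le) simp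
qed

lemma finite_partitions_ge2: "finite (partitions_ge2 n)"
  using finite_partitions by (simp add: partitions_ge2_def)

text \<open>
  A partition of \<open>n\<close> without its parts 1 is a partition of some \<open>k \<le> n\<close> into parts at least 2,
  and the number of removed parts is forced to be \<open>n - k\<close>.
\<close>

lemma card_partitions: "card (partitions n) = (\<Sum>k\<le>n. P1 k)"
proof -
  let ?A = "SIGMA k:{..n}. partitions_ge2 k"
  have "bij_betw (\<lambda>(k, M). M + replicate_mset (n - k) 1) ?A (partitions n)"
  proof (rule bij_betw_byWitness[where f' = "\<lambda>M. (n - count M 1, filter_mset (\<lambda>x. x \<noteq> 1) M)"])
    have "filter_mset (\<lambda>x. x \<noteq> 1) (M + replicate_mset m 1) = M" if "1 \<notin># M"
      for m and M :: "nat multiset"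
      by (rule multiset_eqI) (use that in \<open>auto simp: not_in_iff\<close>)
    then show "\<forall>a\<in>?A. (\<lambda>M. (n - count M 1, filter_mset (\<lambda>x. x \<noteq> 1) M))
        ((\<lambda>(k, M). M + replicate_mset (n - k) 1) a) = a"
      by (auto simp: partitions_ge2_def not_in_iff simp del: filter_union_mset)
    have split: "filter_mset (\<lambda>x. x \<noteq> 1) M + replicate_mset (count M 1) 1 = M"
      for M :: "nat multiset"
      by (rule multiset_eqI) auto
    have sum: "\<Sum>\<^sub># (filter_mset (\<lambda>x. x \<noteq> 1) M) + count M 1 = \<Sum>\<^sub># M" for M :: "nat multiset"
      by (subst (3) split[symmetric]) (simp del: One_nat_def)
    then have le: "count M 1 \<le> n" if "M \<in> partitions n" for M
      using that by (metis (mono_tags, lifting) le_add2 mem_Collect_eq partitions_def)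
    show "\<forall>M\<in>partitions n. (\<lambda>(k, M). M + replicate_mset (n - k) 1)
        (n - count M 1, filter_mset (\<lambda>x. x \<noteq> 1) M) = M"
      using le split by (auto simp del: One_nat_def)
    show "(\<lambda>(k, M). M + replicate_mset (n - k) 1) ` ?A \<subseteq> partitions n"
      by (auto simp: partitions_def partitions_ge2_def split: if_splits)
    show "(\<lambda>M. (n - count M 1, filter_mset (\<lambda>x. x \<noteq> 1) M)) ` partitions n \<subseteq> ?A"
    proof (rule image_subsetI)
      fix M assume M: "M \<in> partitions n"
      then have "\<Sum>\<^sub># (filter_mset (\<lambda>x. x \<noteq> 1) M) = n - count M 1"
        using sum[of M] by (simp add: partitions_def)
      then show "(n - count M 1, filter_mset (\<lambda>x. x \<noteq> 1) M) \<in> ?A"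
        using M by (simp add: partitions_def partitions_ge2_def)
    qed
  qed
  then have "card (partitions n) = card ?A" by (simp add: bij_betw_same_card)
  also have "\<dots> = (\<Sum>k\<le>n. P1 k)" by (simp add: P1_eq finite_partitions_ge2)
  finally show ?thesis .
qed

text \<open>
  The loops and the chains of a type are chosen independently, apart from their total lengths
  adding up to \<open>n\<close>. Fixed points are chains of length 1, so only the loops must avoid the part 1.
\<close>

lemma card_types: "card (types n) = (\<Sum>i\<le>n. P1 i * card (partitions (n - i)))"
proof -
  let ?A = "SIGMA i:{..n}. partitions_ge2 i \<times> partitions (n - i)"
  let ?join = "\<lambda>(i :: nat, L, C). image_mset (Pair True) L + image_mset (Pair False) C"
  let ?L = "\<lambda>M :: (bool \<times> nat) multiset. image_mset snd (filter_mset fst M)"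
  let ?C = "\<lambda>M :: (bool \<times> nat) multiset. image_mset snd (filter_mset (\<lambda>t. \<not> fst t) M)"
  have split: "image_mset (Pair True) (?L M) + image_mset (Pair False) (?C M) = M" for M
    by (induction M) auto
  have L: "?L (image_mset (Pair True) L + image_mset (Pair False) C) = L"
    and C: "?C (image_mset (Pair True) L + image_mset (Pair False) C) = C" for L C
    by (simp_all add: filter_mset_image_mset multiset.map_comp comp_def)
  have sum: "\<Sum>\<^sub># (?L M) + \<Sum>\<^sub># (?C M) = \<Sum>\<^sub># (image_mset snd M)" for M
    by (induction M) auto
  have "bij_betw ?join ?A (types n)"
  proof (rule bij_betw_byWitness[where f' = "\<lambda>M. (\<Sum>\<^sub># (?L M), ?L M, ?C M)"])
    show "\<forall>a\<in>?A. (\<lambda>M. (\<Sum>\<^sub># (?L M), ?L M, ?C M)) (?join a) = a"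
      using L C by (auto simp: partitions_ge2_def partitions_def)
    show "\<forall>M\<in>types n. ?join (\<Sum>\<^sub># (?L M), ?L M, ?C M) = M" using split by simp
    have ge2: "2 \<le> k" if "0 \<notin># L" "Suc 0 \<notin># L" "k \<in># L" for L k
      using that by (cases k rule: nat.exhaust; cases "k - 1") auto
    show "?join ` ?A \<subseteq> types n"
      by (auto simp: types_def partitions_ge2_def partitions_def multiset.map_comp comp_def
          Suc_le_eq intro: ge2 gr0I)
    show "(\<lambda>M. (\<Sum>\<^sub># (?L M), ?L M, ?C M)) ` types n \<subseteq> ?A"
    proof (rule image_subsetI)
      fix M assume "M \<in> types n"
      then have M: "\<And>loop k. (loop, k) \<in># M \<Longrightarrow> 1 \<le> k \<and> (loop \<longrightarrow> 2 \<le> k)"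
        and n: "\<Sum>\<^sub># (?L M) + \<Sum>\<^sub># (?C M) = n"
        using sum by (auto simp: types_def)
      show "(\<Sum>\<^sub># (?L M), ?L M, ?C M) \<in> ?A"
        using M n by (fastforce simp: partitions_ge2_def partitions_def)
    qed
  qed
  then have "card (types n) = card ?A" by (simp add: bij_betw_same_card)
  also have "\<dots> = (\<Sum>i\<le>n. P1 i * card (partitions (n - i)))"
    by (simp add: P1_eq finite_partitions_ge2 finite_partitions card_cartesian_product)
  finally show ?thesis .
qed

lemma P1_0: "P1 0 = 1"
proof -
  have "M = {#}" if "M \<in> partitions_ge2 0" for M
    using that by (cases M) (auto simp: partitions_ge2_def partitions_def)
  then have "partitions_ge2 0 = {{#}}"
    by (auto simp: partitions_ge2_def partitions_def)
  then show ?thesis by (simp add: P1_eq)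
qed

lemma P1_1: "P1 1 = 0"
proof -
  have "M \<notin> partitions_ge2 1" for M
    by (cases M) (auto simp: partitions_ge2_def partitions_def add_is_1)
  then have "partitions_ge2 1 = {}" by blast
  then show ?thesis unfolding P1_eq by simp
qed

lemma Inv_eq_convolution: "Inv n = (\<Sum>k\<le>n. \<Sum>i\<le>k. P1 i * P1 (k - i))"
proof -
  have "Inv n = (\<Sum>i\<le>n. \<Sum>j\<le>n - i. P1 i * P1 j)"
    by (simp add: Inv_eq_card_types card_types card_partitions sum_distrib_left)
  also have "\<dots> = (\<Sum>(i, j)\<in>{(i, j). i + j \<le> n}. P1 i * P1 j)"
    by (subst sum.Sigma) (auto intro!: sum.cong)
  also have "\<dots> = (\<Sum>k\<le>n. \<Sum>i\<le>k. P1 i * P1 (k - i))"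
    by (rule sum.triangle_reindex_eq)
  finally show ?thesis .
qed

theorem propositionA7:
  fixes n :: nat
  assumes "n \<ge> 1"
  shows "Inv n = 1 + 2 * (\<Sum>k = 2..n. P1 k)
    + (\<Sum>k = 4..n. \<Sum>i = 2..k - 2. P1 i * P1 (k - i))"
proof -
  let ?c = "\<lambda>k. \<Sum>i\<le>k. P1 i * P1 (k - i)"
  let ?d = "\<lambda>k. \<Sum>i = 2..k - 2. P1 i * P1 (k - i)"
  have conv: "?c k = 2 * P1 k + ?d k" if "2 \<le> k" for k
  proof -
    have "?c k = (\<Sum>i\<in>{0, k} \<union> {2..k - 2}. P1 i * P1 (k - i))"
    proof (rule sum.mono_neutral_right)
      have "i = 1 \<or> k - i = 1" if "i \<in> {..k} - ({0, k} \<union> {2..k - 2})" for i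
        using that by auto
      then show "\<forall>i\<in>{..k} - ({0, k} \<union> {2..k - 2}). P1 i * P1 (k - i) = 0"
        using P1_1 by (metis mult_zero_left mult_zero_right)
    qed auto
    also have "\<dots> = (\<Sum>i\<in>{0, k}. P1 i * P1 (k - i)) + ?d k"
      using that by (intro sum.union_disjoint) auto
    finally show ?thesis using that P1_0 by simp
  qed
  have "{..n} = {0, 1} \<union> {2..n}" using assms by auto
  then have "Inv n = ?c 0 + ?c 1 + (\<Sum>k = 2..n. ?c k)"
    unfolding Inv_eq_convolution by (simp add: sum.union_disjoint)
  also have "?c 0 + ?c 1 = 1" using P1_0 P1_1 by (simp add: atMost_Suc)
  also have "(\<Sum>k = 2..n. ?c k) = 2 * (\<Sum>k = 2..n. P1 k) + (\<Sum>k = 2..n. ?d k)"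
    using conv by (simp add: sum.distrib sum_distrib_left)
  also have "(\<Sum>k = 2..n. ?d k) = (\<Sum>k = 4..n. ?d k)"
    by (rule sum.mono_neutral_right) auto
  finally show ?thesis by simp
qed

end
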